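(* Let $Y_0,\kappa,\epsilon>0$ and $Y(x)=Y_0\exp\big(\kappa\frac{\log x}{(\log\log(x+1))^{1+\epsilon}}\big)$. Then $\log Y$ is a maximal element, with respect to $<_\exists$, of the set of logarithms of subradical functions. In other words, for any subradical function $s=s(x)$, either $\log s<_\exists\log Y$ or $\log s$ and $\log Y$ are incomparable (neither $\log s<_\exists\log Y$ nor $\log Y<_\exists\log s$).
   Context: Functions are real-valued functions of a real variable $x$ defined for all sufficiently large $x$, and $o(\cdot)$ refers to $x\to\infty$. A function $f$ is subradical if $f(x)=o(x^{\delta})$ for every $\delta>0$; when $\log s$ is written, $s$ is (eventually) positive. $f<_\exists g$ ("$f$ is radically dominated by $g$", written $<_{\sqrt[\exists]{\ }}$ in the paper) means: $g$ is eventually non-negative (so that its real powers make sense) and there is $0<\delta<1$ with $f=o(g^{1-\delta})$. *)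

theory Defs
  imports Complex_Main "HOL-Library.Landau_Symbols"
begin

text \<open>
  A real function defined for all sufficiently large arguments is represented by a total function
  of type \<^typ>\<open>real \<Rightarrow> real\<close>; every notion below depends only on its values near infinity.
\<close>

definition subradical :: "(real \<Rightarrow> real) \<Rightarrow> bool" where
  "subradical f \<longleftrightarrow> (\<forall>\<delta>>0. f \<in> o[at_top](\<lambda>x. x powr \<delta>))"

definition rad_dominated :: "(real \<Rightarrow> real) \<Rightarrow> (real \<Rightarrow> real) \<Rightarrow> bool"
    (infix "\<prec>\<^sub>r" 50) where
  "f \<prec>\<^sub>r g \<longleftrightarrow>
     (\<forall>\<^sub>F x in at_top. g x \<ge> 0) \<and>
     (\<exists>\<delta>. 0 < \<delta> \<and> \<delta> < 1 \<and> f \<in> o[at_top](\<lambda>x. g x powr (1 - \<delta>)))"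

definition rad_incomparable :: "(real \<Rightarrow> real) \<Rightarrow> (real \<Rightarrow> real) \<Rightarrow> bool" where
  "rad_incomparable f g \<longleftrightarrow> \<not> f \<prec>\<^sub>r g \<and> \<not> g \<prec>\<^sub>r f"

text \<open>Functions agreeing near infinity are identified, hence the eventual equality.\<close>

definition log_subradical :: "(real \<Rightarrow> real) set" where
  "log_subradical =
     {f. \<exists>s. subradical s \<and> (\<forall>\<^sub>F x in at_top. s x > 0) \<and> (\<forall>\<^sub>F x in at_top. f x = ln (s x))}"

text \<open>
  Maximality for a relation read as strict. Note that \<open>\<prec>\<^sub>r\<close> is not irreflexive on all functions
  (for example, the zero function is dominated by itself); the definition
  also excludes \<open>R m m\<close>.
\<close>

definition maximal_element :: "('a \<Rightarrow> 'a \<Rightarrow> bool) \<Rightarrow> 'a set \<Rightarrow> 'a \<Rightarrow> bool" where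
  "maximal_element R A m \<longleftrightarrow> m \<in> A \<and> (\<forall>t\<in>A. \<not> R m t)"

end

theory Submission
  imports Defs "HOL-Real_Asymp.Real_Asymp"
begin

text \<open>
  The logarithm of a subradical function is eventually at most \<open>ln x\<close>, so whatever it radically
  dominates is \<open>o((ln x) powr (1 - \<delta>))\<close> for some \<open>\<delta> > 0\<close>. On the other hand, \<open>ln (Y x)\<close> falls short
  of \<open>ln x\<close> only by a power of \<open>ln (ln x)\<close>, and hence outgrows all of these powers of \<open>ln x\<close>. So no
  logarithm of a subradical function dominates \<open>ln Y\<close>. Yet that power of \<open>ln (ln x)\<close> tends to
  infinity, so \<open>ln (Y x) = o(ln x)\<close> and \<open>Y\<close> is itself subradical.
\<close>

text \<open>
  Since \<open>s x \<le> x\<close> eventually, \<open>g \<prec>\<^sub>r ln s\<close> would make \<open>g\<close> both smaller and larger than a power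
  \<open>(ln x) powr (1 - \<delta>)\<close>.
\<close>

lemma not_rad_dominated_by_log_subradical:
  assumes large: "\<And>\<delta>. 0 < \<delta> \<Longrightarrow> \<delta> < 1 \<Longrightarrow> (\<lambda>x. ln x powr (1 - \<delta>)) \<in> o[at_top](g)"
    and f: "f \<in> log_subradical"
  shows "\<not> g \<prec>\<^sub>r f"
proof
  assume "g \<prec>\<^sub>r f"
  then obtain \<delta> where nonneg: "\<forall>\<^sub>F x in at_top. f x \<ge> 0" and \<delta>: "0 < \<delta>" "\<delta> < 1"
    and small: "g \<in> o[at_top](\<lambda>x. f x powr (1 - \<delta>))"
    by (auto simp: rad_dominated_def)
  obtain s where s: "subradical s" "\<forall>\<^sub>F x in at_top. s x > 0" "\<forall>\<^sub>F x in at_top. f x = ln (s x)"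
    using f by (auto simp: log_subradical_def)
  have "s \<in> o[at_top](\<lambda>x. x powr 1)"
    using s(1) unfolding subradical_def by (metis zero_less_one)
  then have "\<forall>\<^sub>F x in at_top. norm (s x) \<le> 1 * norm (x powr 1)"
    by (rule landau_o.smallD) simp
  then have "\<forall>\<^sub>F x in at_top. f x powr (1 - \<delta>) \<le> ln x powr (1 - \<delta>)"
    using s(2,3) nonneg eventually_gt_at_top[of 0]
  proof eventually_elim
    case (elim x)
    then have "f x \<le> ln x" by simp
    with elim \<delta> show ?case by (intro powr_mono2) auto
  qed
  then have "(\<lambda>x. f x powr (1 - \<delta>)) \<in> O[at_top](\<lambda>x. ln x powr (1 - \<delta>))"
    by (intro bigoI[of _ 1]) (auto elim: eventually_mono)
  then have "g \<in> o[at_top](\<lambda>x. ln x powr (1 - \<delta>))"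
    using small by (rule landau_o.small_big_trans[rotated])
  then have "(\<lambda>x. ln x powr (1 - \<delta>)) \<in> o[at_top](\<lambda>x. ln x powr (1 - \<delta>))"
    using large[OF \<delta>] by (rule landau_o.small_trans[rotated])
  then have "\<forall>\<^sub>F x :: real in at_top. ln x powr (1 - \<delta>) = 0"
    by (simp add: landau_o.small_refl_iff)
  moreover have "\<forall>\<^sub>F x :: real in at_top. ln x powr (1 - \<delta>) > 0"
    by real_asymp
  ultimately have "\<forall>\<^sub>F x :: real in at_top. False"
    by eventually_elim simp
  then show False by simp
qed

lemma powr_ln_smallo_ln_Y:
  fixes Y\<^sub>0 \<kappa> \<epsilon> \<delta> :: real
  assumes "\<kappa> > 0" "\<epsilon> > 0" "\<delta> > 0"
  shows "(\<lambda>x. ln x powr (1 - \<delta>))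
    \<in> o[at_top](\<lambda>x. ln Y\<^sub>0 + \<kappa> * (ln x / (ln (ln (x + 1))) powr (1 + \<epsilon>)))"
  using assms by real_asymp

lemma subradical_Y:
  fixes Y\<^sub>0 \<kappa> \<epsilon> :: real
  assumes "Y\<^sub>0 > 0" "\<kappa> > 0" "\<epsilon> > 0"
  shows "subradical (\<lambda>x. Y\<^sub>0 * exp (\<kappa> * (ln x / (ln (ln (x + 1))) powr (1 + \<epsilon>))))"
  unfolding subradical_def
proof (intro allI impI)
  fix \<delta> :: real assume "\<delta> > 0"
  with assms show "(\<lambda>x. Y\<^sub>0 * exp (\<kappa> * (ln x / (ln (ln (x + 1))) powr (1 + \<epsilon>))))
      \<in> o[at_top](\<lambda>x. x powr \<delta>)"
    by real_asymp
qed

theorem proposition6p4: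
  fixes Y\<^sub>0 \<kappa> \<epsilon> :: real and Y :: "real \<Rightarrow> real"
  assumes "Y\<^sub>0 > 0" and "\<kappa> > 0" and "\<epsilon> > 0"
    and "\<forall>\<^sub>F x in at_top. Y x = Y\<^sub>0 * exp (\<kappa> * (ln x / (ln (ln (x + 1))) powr (1 + \<epsilon>)))"
  shows "maximal_element (\<prec>\<^sub>r) log_subradical (\<lambda>x. ln (Y x)) \<and>
    (\<forall>s :: real \<Rightarrow> real. subradical s \<longrightarrow> (\<forall>\<^sub>F x in at_top. s x > 0) \<longrightarrow>
       (\<lambda>x. ln (s x)) \<prec>\<^sub>r (\<lambda>x. ln (Y x)) \<or>
       rad_incomparable (\<lambda>x. ln (s x)) (\<lambda>x. ln (Y x)))"
proof -
  have ln_Y: "\<forall>\<^sub>F x in at_top. ln (Y x) = ln Y\<^sub>0 + \<kappa> * (ln x / (ln (ln (x + 1))) powr (1 + \<epsilon>))"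
    using assms(4) by eventually_elim (use assms(1) in \<open>simp add: ln_mult\<close>)
  have "(\<lambda>x. ln x powr (1 - \<delta>)) \<in> o[at_top](\<lambda>x. ln (Y x))" if "0 < \<delta>" "\<delta> < 1" for \<delta>
    using powr_ln_smallo_ln_Y[OF assms(2,3) that(1), of Y\<^sub>0] landau_o.small.cong[OF ln_Y] by simp
  then have not_dominated: "\<not> (\<lambda>x. ln (Y x)) \<prec>\<^sub>r f" if "f \<in> log_subradical" for f
    using that by (rule not_rad_dominated_by_log_subradical)
  have "(\<lambda>x. ln (Y x)) \<in> log_subradical"
    unfolding log_subradical_def mem_Collect_eq
  proof (intro exI conjI)
    show "subradical Y"
      using subradical_Y[OF assms(1-3)] landau_o.small.in_cong[OF assms(4)]
      by (simp add: subradical_def)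
    show "\<forall>\<^sub>F x in at_top. Y x > 0"
      using assms(4) by eventually_elim (use assms(1) in simp)
  qed simp
  then have "maximal_element (\<prec>\<^sub>r) log_subradical (\<lambda>x. ln (Y x))"
    using not_dominated by (simp add: maximal_element_def)
  moreover have "(\<lambda>x. ln (s x)) \<in> log_subradical"
    if "subradical s" "\<forall>\<^sub>F x in at_top. s x > 0" for s
    using that by (auto simp: log_subradical_def)
  ultimately show ?thesis
    using not_dominated by (auto simp: rad_incomparable_def)
qed

end
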